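(* Let $N_v \ge 1$ and $T\ge 1$ be integers, let $X$ be a fixed prompt (a finite sequence of elements of $\{1,\dots,N_v\}$), and let $\pi_\theta$ be a language model, i.e. a deterministic function assigning to each pair consisting of a prompt $X$ and a finite sequence $Y_{1:t}=(Y_1,\dots,Y_t)$ of tokens ($t \ge 0$) a probability vector $\pi_\theta(X,Y_{1:t})$ on $\{1,\dots,N_v\}$. Let $Q$ denote the quantile function of the standard Gumbel distribution $G(0,1)$, so that $Q^{-1}$ is its cumulative distribution function. Consider the random token sequence $Y_{1:T}$ generated autoregressively as follows. Let $g_1 = (g_1^1,\dots,g_1^{N_v})$ have independent $G(0,1)$ entries, let $h_1 = \pi_\theta(X)$ (the empty response), and let $Y_1 = \operatorname{arg\,max}_j (\log h_1^j + g_1^j)$. For $1 \le t < T$, with $k := \operatorname{arg\,max}_j (g_t^j + \log h_t^j)$ (so $k = Y_t$), set $$h_{t+1} = \pi_\theta(X, Y_{1:t}),$$ let $g_{t+1}^k$ be a fresh draw from $G(0,1)$, independent of everything generated up to step $t$, and for $i \ne k$ set $$g_{t+1}^i = Q\!\left(\frac{Q^{-1}(g_t^i)}{Q^{-1}\big(g_t^k + \log h_t^k - \log h_t^i\big)}\right),$$ and finally $$Y_{t+1} = \operatorname{arg\,max}_j \big(\log h_{t+1}^j + g_{t+1}^j\big).$$ Then for every $0 \le t < T$ the conditional distribution of $Y_{t+1}$ given the preceding tokens is the categorical distribution with parameters $h_{t+1} = \pi_\theta(X,Y_{1:t})$: $$p(Y_{t+1} \mid X, Y_{1:t}) = \mathrm{Cat}(Y_{t+1};\,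 h_{t+1}),$$ that is, $P(Y_{t+1} = y \mid Y_{1:t} = y_{1:t}) = \pi_\theta(X,y_{1:t})^{y}$ (the $y$-th entry of the probability vector) for every token $y$ and every $y_{1:t}$ with $P(Y_{1:t}=y_{1:t})>0$.
   Context: The standard Gumbel distribution $G(0,1)$ has cumulative distribution function $Q^{-1}(x) = e^{-e^{-x}}$ and quantile function $Q(u) = -\log(-\log u)$ for $u\in(0,1)$. Subscripts denote position in the sequence; superscripts denote the token (vocabulary) index, so $h_t^i$ is the probability the model assigns to token $i$ at position $t$ and $g_t^i$ is the $i$-th entry of the noise vector at position $t$. Tokens are elements of the vocabulary $\{1,\dots,N_v\}$. $\mathrm{Cat}(y;h)=h^y$ is the categorical distribution with parameter vector $h$. Conventions: $\log 0=-\infty$ and $Q^{-1}(+\infty)=1$. Each arg max is almost surely attained at a unique index, and the argument of $Q$ almost surely lies in $(0,1)$. *)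

theory Defs
  imports "HOL-Probability.Probability"
begin

text \<open>Cumulative distribution function $Q^{-1}$ of $G(0,1)$, extended to the extended reals by its
  limits, so that in particular $Q^{-1}(+\infty) = 1$.\<close>

definition gumbel_cdf :: "ereal \<Rightarrow> real" where
  "gumbel_cdf x = (case x of ereal r \<Rightarrow> exp (- exp (- r)) | PInfty \<Rightarrow> 1 | MInfty \<Rightarrow> 0)"

text \<open>Only meaningful for arguments in $(0,1)$.\<close>

definition gumbel_quantile :: "real \<Rightarrow> real" where
  "gumbel_quantile u = - ln (- ln u)"

lemma gumbel_cdf_quantile:
  assumes "0 < u" "u < 1"
  shows "gumbel_cdf (ereal (gumbel_quantile u)) = u"
  using assms by (simp add: gumbel_cdf_def gumbel_quantile_def)

lemma gumbel_quantile_cdf: "gumbel_quantile (gumbel_cdf (ereal x)) = x"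
  by (simp add: gumbel_cdf_def gumbel_quantile_def)

definition std_gumbel :: "'a measure \<Rightarrow> ('a \<Rightarrow> real) \<Rightarrow> bool" where
  "std_gumbel M Z \<longleftrightarrow>
     Z \<in> borel_measurable M \<and> (\<forall>x. cdf (distr M borel Z) x = gumbel_cdf (ereal x))"

text \<open>The logarithm of a probability, with $\log 0 = -\infty$ (whereas \<^term>\<open>ln (0::real)\<close> is $0$).\<close>

definition elog :: "real \<Rightarrow> ereal" where
  "elog p = (if p = 0 then - \<infinity> else ereal (ln p))"

text \<open>Tokens are the natural numbers in \<^term>\<open>{1..N}\<close>. A language model maps a prompt and a partial
  response to a vector whose entries with index in \<^term>\<open>{1..N}\<close> form a probability vector; other
  entries are irrelevant.\<close>

definition language_model :: "nat \<Rightarrow> (nat list \<Rightarrow> nat list \<Rightarrow> nat \<Rightarrow> real) \<Rightarrow> bool" where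
  "language_model N \<pi> \<longleftrightarrow>
     (\<forall>X ys. set X \<subseteq> {1..N} \<longrightarrow> set ys \<subseteq> {1..N} \<longrightarrow>
        (\<forall>i\<in>{1..N}. 0 \<le> \<pi> X ys i) \<and> (\<Sum>i = 1..N. \<pi> X ys i) = 1)"

text \<open>The random response $Y_{1:t}$; positions are counted from $1$.\<close>

definition tokens_upto :: "(nat \<Rightarrow> 'a \<Rightarrow> nat) \<Rightarrow> nat \<Rightarrow> 'a \<Rightarrow> nat list" where
  "tokens_upto Y t \<omega> = map (\<lambda>s. Y s \<omega>) [1..<Suc t]"

text \<open>The random vector $h_t = \pi(X, Y_{1:t-1})$, for $t \ge 1$.\<close>

definition token_probs ::
  "(nat list \<Rightarrow> nat list \<Rightarrow> nat \<Rightarrow> real) \<Rightarrow> nat list \<Rightarrow> (nat \<Rightarrow> 'a \<Rightarrow> nat) \<Rightarrow> nat \<Rightarrow> 'a \<Rightarrow> nat \<Rightarrow> real"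
where
  "token_probs \<pi> X Y t \<omega> = \<pi> X (tokens_upto Y (t - 1) \<omega>)"

text \<open>All noise vectors and tokens generated up to step $t$, as a single random element.\<close>

definition history_space :: "nat \<Rightarrow> nat \<Rightarrow> (nat \<Rightarrow> (nat \<Rightarrow> real) \<times> nat) measure" where
  "history_space N t =
     (\<Pi>\<^sub>M s\<in>{1..t}. (\<Pi>\<^sub>M i\<in>{1..N}. borel) \<Otimes>\<^sub>M count_space {1..N})"

definition history ::
  "nat \<Rightarrow> (nat \<Rightarrow> nat \<Rightarrow> 'a \<Rightarrow> real) \<Rightarrow> (nat \<Rightarrow> 'a \<Rightarrow> nat) \<Rightarrow> nat \<Rightarrow> 'a \<Rightarrow> nat \<Rightarrow> (nat \<Rightarrow> real) \<times> nat"
where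
  "history N g Y t \<omega> = (\<lambda>s\<in>{1..t}. (\<lambda>i\<in>{1..N}. g s i \<omega>, Y s \<omega>))"

end

theory Submission
  imports Defs
begin

text \<open>With \<open>E i = exp (- g i)\<close>, standard Gumbel noise becomes exponential noise of rate 1, and the
  Gumbel-max rule selects the \<open>k\<close> minimising the arrival time \<open>E i / h i\<close>, which is a race
  of independent exponential clocks of rates \<open>h i\<close>. The recursion for \<open>g\<close> then reads
  \<open>E' i = E i - h i * (E k / h k)\<close>: every losing clock is restarted at the moment when the race ends.
  By memorylessness the residual clocks are again independent exponentials of rate 1 and independent of
  the winner; adding the fresh clock \<open>E' k\<close>, one gets by induction on \<open>t\<close> that the noise at
  position \<open>t + 1\<close> consists of independent exponentials given \<open>Y 1, \<dots>, Y t\<close>. Ties have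
  probability zero because the events "\<open>k\<close> wins strictly" are disjoint and their probabilities
  \<open>h k\<close> sum to 1.\<close>

section \<open>From Gumbel to exponential noise\<close>

definition exp_law :: "real measure" where
  "exp_law = density lborel (\<lambda>x. ennreal (exponential_density 1 x))"

lemma sets_exp_law [simp, measurable_cong]: "sets exp_law = sets borel"
  by (simp add: exp_law_def)

lemma space_exp_law [simp]: "space exp_law = UNIV"
  by (simp add: exp_law_def)

lemma prob_space_exp_law: "prob_space exp_law"
  unfolding exp_law_def by (rule prob_space_exponential_density) simp

lemma AE_exp_law_nonneg: "AE x in exp_law. 0 \<le> x"
  unfolding exp_law_def by (subst AE_density) (auto simp: exponential_density_def)

text \<open>Shifting Lebesgue measure by \<open>c\<close> turns the density \<open>exp (- x)\<close>
  into \<open>exp (- c) * exp (- x)\<close>. Keeping the survival event and the location of the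
  residual in one set gives both the survival probability and the law of the residual.\<close>

lemma exp_law_memoryless:
  assumes "0 \<le> c" and [measurable]: "F \<in> sets borel"
  shows "emeasure exp_law {x. 0 < x - c \<and> x - c \<in> F} = ennreal (exp (- c)) * emeasure exp_law F"
proof -
  have "emeasure exp_law {x. 0 < x - c \<and> x - c \<in> F} =
      (\<integral>\<^sup>+x. ennreal (exponential_density 1 x) * indicator {x. 0 < x - c \<and> x - c \<in> F} x \<partial>lborel)"
    unfolding exp_law_def by (rule emeasure_density) auto
  also have "\<dots> = (\<integral>\<^sup>+x. ennreal (exponential_density 1 (c + 1 * x)) *
      indicator {x. 0 < x - c \<and> x - c \<in> F} (c + 1 * x) \<partial>lborel)"
    by (subst nn_integral_real_affine[where c = 1 and t = c]) auto
  also have "\<dots> = (\<integral>\<^sup>+x. ennreal (exp (- c)) * (ennreal (exponential_density 1 x) * indicator F x) \<partial>lborel)"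
  proof (rule nn_integral_cong_AE)
    \<comment> \<open>The integrands can differ only at 0, where the density is positive but the
      strict inequality fails.\<close>
    have "AE x in lborel. x \<noteq> (0::real)"
      by (rule AE_lborel_singleton)
    then show "AE x in lborel. ennreal (exponential_density 1 (c + 1 * x)) *
        indicator {x. 0 < x - c \<and> x - c \<in> F} (c + 1 * x) =
        ennreal (exp (- c)) * (ennreal (exponential_density 1 x) * indicator F x)"
      by eventually_elim
        (use assms(1) in \<open>auto simp: exponential_density_def indicator_def exp_add[symmetric]
           exp_minus exp_diff field_simps simp flip: ennreal_mult\<close>)
  qed
  also have "\<dots> = ennreal (exp (- c)) * emeasure exp_law F"
    by (simp add: exp_law_def nn_integral_cmult emeasure_density)
  finally show ?thesis .
qed

text \<open>For positive \<open>a\<close>, the event \<open>exp (- Z) \<le> a\<close> is the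
  complement of \<open>Z < - ln a\<close>, whose probability is \<open>exp (- a)\<close>; this is
  the exponential distribution function.\<close>

lemma (in prob_space) std_gumbel_exp_law:
  assumes "std_gumbel M Z"
  shows "distr M borel (\<lambda>\<omega>. exp (- Z \<omega>)) = exp_law"
proof -
  have Z [measurable]: "Z \<in> borel_measurable M"
    and cdf: "\<And>x. cdf (distr M borel Z) x = exp (- exp (- x))"
    using assms by (auto simp: std_gumbel_def gumbel_cdf_def)
  interpret Z: real_distribution "distr M borel Z"
    by (rule real_distribution_distr) simp
  \<comment> \<open>The distribution function is continuous, so there are no atoms. The decreasing
    map \<open>exp (- Z)\<close> asks for the probability of \<open>Z < x\<close>, whereas the cdf
    speaks of \<open>Z \<le> x\<close>.\<close>
  have atom: "Z.prob {x} = 0" for x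
    by (subst Z.isCont_cdf[symmetric]) (auto simp: cdf[abs_def] intro!: continuous_intros)
  have lt: "\<P>(\<omega> in M. Z \<omega> < x) = exp (- exp (- x))" for x
  proof -
    have "exp (- exp (- x)) = Z.prob ({..<x} \<union> {x})"
      by (simp add: cdf[symmetric] cdf_def lessThan_Suc_atMost ivl_disj_un_singleton(2) del: Un_insert_right)
    also have "\<dots> = Z.prob {..<x}"
      by (subst Z.finite_measure_Union) (auto simp: atom)
    finally show ?thesis
      by (simp add: measure_distr vimage_def Int_def conj_commute)
  qed
  have le: "emeasure M {x \<in> space M. exp (- Z x) \<le> a} = 1 - ennreal (exp (- a * 1))" if a: "0 \<le> a" for a
  proof (cases "a = 0")
    case False
    have "exp (- Z x) \<le> a \<longleftrightarrow> \<not> Z x < - ln a" for x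
    proof -
      have "exp (- Z x) \<le> exp (ln a) \<longleftrightarrow> \<not> Z x < - ln a"
        by (simp only: exp_le_cancel_iff) linarith
      with False a show ?thesis by simp
    qed
    then have "prob {x \<in> space M. exp (- Z x) \<le> a} = 1 - \<P>(\<omega> in M. Z \<omega> < - ln a)"
      by (subst prob_neg[symmetric]) auto
    then show ?thesis
      using False a by (simp add: lt emeasure_eq_measure ennreal_minus flip: ennreal_1)
  next
    case True
    have "{x \<in> space M. exp (- Z x) \<le> a} = {}" by (simp add: True)
    then show ?thesis by (simp add: True)
  qed
  have "distributed M lborel (\<lambda>\<omega>. exp (- Z \<omega>)) (exponential_density 1)"
    by (rule exponential_distributedI) (auto simp: le[simplified])
  then show ?thesis
    by (simp add: distributed_def exp_law_def cong: distr_cong)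
qed

section \<open>Races of independent exponential clocks\<close>

definition race_excess :: "('i \<Rightarrow> real) \<Rightarrow> 'i \<Rightarrow> ('i \<Rightarrow> real) \<Rightarrow> 'i \<Rightarrow> real" where
  "race_excess h k e i = e i - h i / h k * e k"

text \<open>When \<open>h i > 0\<close>, positive excess means \<open>e k / h k < e i / h i\<close>.
  Multiplying through by \<open>h i\<close> also covers \<open>h i = 0\<close>, a clock that never
  rings: its excess is \<open>e i\<close> itself.\<close>

definition race_winner :: "'i set \<Rightarrow> ('i \<Rightarrow> real) \<Rightarrow> 'i \<Rightarrow> ('i \<Rightarrow> real) \<Rightarrow> bool" where
  "race_winner I h k e \<longleftrightarrow> k \<in> I \<and> 0 < h k \<and> (\<forall>i\<in>I - {k}. 0 < race_excess h k e i)"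

lemma race_winner_unique:
  assumes "race_winner I h k e" "race_winner I h l e"
  shows "k = l"
proof (rule ccontr)
  assume "k \<noteq> l"
  with assms have "0 < h k" "0 < h l" "e l > h l / h k * e k" "e k > h k / h l * e l"
    by (auto simp: race_winner_def race_excess_def)
  then show False
    by (simp add: field_simps)
qed

lemma measurable_race_excess:
  assumes "i \<in> I" "k \<in> I" "sets D = sets borel"
  shows "(\<lambda>e. race_excess h k e i) \<in> borel_measurable (\<Pi>\<^sub>M i\<in>I. D)"
proof -
  have "(\<lambda>e. e j) \<in> borel_measurable (\<Pi>\<^sub>M i\<in>I. D)" if "j \<in> I" for j
    using measurable_component_singleton[OF that, of "\<lambda>_. D"] measurable_cong_sets[OF refl assms(3)]
    by metis
  with assms show ?thesis
    unfolding race_excess_def by (intro borel_measurable_diff borel_measurable_times) auto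
qed

text \<open>\<open>D\<close> is kept general because the same set is used both in the product of
  \<open>borel\<close> and in the product of \<open>exp_law\<close>.\<close>

lemma sets_race_excess:
  assumes "finite I" "k \<in> I" "sets D = sets borel" "\<And>i. i \<in> I - {k} \<Longrightarrow> F i \<in> sets borel"
  shows "{e \<in> space (\<Pi>\<^sub>M i\<in>I. D). \<forall>i\<in>I - {k}. 0 < race_excess h k e i \<and> race_excess h k e i \<in> F i}
    \<in> sets (\<Pi>\<^sub>M i\<in>I. D)"
proof -
  have "{e \<in> space (\<Pi>\<^sub>M i\<in>I. D). race_excess h k e i \<in> {0<..} \<inter> F i} \<in> sets (\<Pi>\<^sub>M i\<in>I. D)"
    if "i \<in> I - {k}" for i
    using that assms by (intro measurable_sets_Collect[OF measurable_race_excess]) auto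
  with \<open>finite I\<close> show ?thesis
    by (intro sets.sets_Collect_finite_All) auto
qed

text \<open>Fix the winning clock at \<open>e k = y\<close>. By memorylessness each other clock
  \<open>i\<close> survives with probability \<open>exp (- (h i / h k * y))\<close>, and its
  residual is again exponential. The survival factors and the density \<open>exp (- y)\<close>
  multiply to \<open>exp (- y / h k)\<close>, which integrates to \<open>h k\<close>. Thus
  \<open>k\<close> wins with probability \<open>h k\<close>, and the residuals are independent
  exponentials given this.\<close>

lemma race_excess_law:
  assumes "finite I" "k \<in> I" "0 < h k" "\<And>i. i \<in> I \<Longrightarrow> 0 \<le> h i" "sum h I = 1"
    and [measurable]: "\<And>i. i \<in> I - {k} \<Longrightarrow> F i \<in> sets borel"
  shows "emeasure (\<Pi>\<^sub>M i\<in>I. exp_law)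
      {e \<in> space (\<Pi>\<^sub>M i\<in>I. exp_law). \<forall>i\<in>I - {k}. 0 < race_excess h k e i \<and> race_excess h k e i \<in> F i} =
    ennreal (h k) * (\<Prod>i\<in>I - {k}. emeasure exp_law (F i))"
    (is "emeasure ?P ?S = _")
proof -
  interpret product_sigma_finite "\<lambda>_. exp_law"
    by unfold_locales (rule sigma_finite_measure.sigma_finite_countable[OF prob_space_imp_sigma_finite[OF prob_space_exp_law]])
  let ?J = "I - {k}"
  let ?c = "\<lambda>i. h i / h k"
  have I: "insert k ?J = I" using assms(2) by auto
  have S [measurable]: "?S \<in> sets ?P"
    using assms by (intro sets_race_excess) auto
  \<comment> \<open>With coordinate \<open>k\<close> frozen at \<open>y\<close>, the set becomes a
    rectangle in the remaining coordinates.\<close>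
  have inner: "(\<integral>\<^sup>+x. indicator ?S (x(k := y)) \<partial>(\<Pi>\<^sub>M i\<in>?J. exp_law)) =
      ennreal (exp (- ((1 - h k) / h k * y))) * (\<Prod>i\<in>?J. emeasure exp_law (F i))"
    if y: "0 \<le> y" for y
  proof -
    let ?G = "\<lambda>i. {x. 0 < x - ?c i * y \<and> x - ?c i * y \<in> F i}"
    have "(\<integral>\<^sup>+x. indicator ?S (x(k := y)) \<partial>(\<Pi>\<^sub>M i\<in>?J. exp_law)) =
        (\<integral>\<^sup>+x. indicator (\<Pi>\<^sub>E i\<in>?J. ?G i) x \<partial>(\<Pi>\<^sub>M i\<in>?J. exp_law))"
      using assms(2)
      by (intro nn_integral_cong)
        (auto simp: indicator_def race_excess_def space_PiM PiE_iff extensional_def)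
    also have "\<dots> = emeasure (\<Pi>\<^sub>M i\<in>?J. exp_law) (\<Pi>\<^sub>E i\<in>?J. ?G i)"
      using assms(1) by (intro nn_integral_indicator sets_PiM_I_finite) auto
    also have "\<dots> = (\<Prod>i\<in>?J. emeasure exp_law (?G i))"
      using assms(1) by (intro emeasure_PiM) auto
    also have "\<dots> = (\<Prod>i\<in>?J. ennreal (exp (- (?c i * y))) * emeasure exp_law (F i))"
      using assms y by (intro prod.cong refl exp_law_memoryless) auto
    also have "\<dots> = ennreal (\<Prod>i\<in>?J. exp (- (?c i * y))) * (\<Prod>i\<in>?J. emeasure exp_law (F i))"
      by (simp add: prod.distrib prod_ennreal)
    also have "(\<Prod>i\<in>?J. exp (- (?c i * y))) = exp (- ((\<Sum>i\<in>?J. h i) / h k * y))"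
      using assms(1) by (simp add: exp_sum[symmetric] sum_negf sum_divide_distrib sum_distrib_right)
    also have "(\<Sum>i\<in>?J. h i) = 1 - h k"
      using assms(1,2,5) by (simp add: sum_diff1)
    finally show ?thesis .
  qed
  have "emeasure ?P ?S = (\<integral>\<^sup>+x. indicator ?S x \<partial>(\<Pi>\<^sub>M i\<in>insert k ?J. exp_law))"
    using S by (simp only: I nn_integral_indicator)
  also have "\<dots> = (\<integral>\<^sup>+y. (\<integral>\<^sup>+x. indicator ?S (x(k := y)) \<partial>(\<Pi>\<^sub>M i\<in>?J. exp_law)) \<partial>exp_law)"
    using assms(1) by (intro product_nn_integral_insert_rev) (auto simp only: I, measurable)
  also have "\<dots> = (\<integral>\<^sup>+y. ennreal (exp (- ((1 - h k) / h k * y))) * (\<Prod>i\<in>?J. emeasure exp_law (F i)) \<partial>exp_law)"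
    using AE_exp_law_nonneg by (intro nn_integral_cong_AE) (auto elim!: eventually_mono simp: inner)
  also have "\<dots> = (\<integral>\<^sup>+y. ennreal (exponential_density 1 y) *
      (ennreal (exp (- ((1 - h k) / h k * y))) * (\<Prod>i\<in>?J. emeasure exp_law (F i))) \<partial>lborel)"
    unfolding exp_law_def by (subst nn_integral_density) auto
  \<comment> \<open>The exponents add up to \<open>- y / h k\<close>; extracting \<open>h k\<close>
    leaves a normalised density of rate \<open>1 / h k\<close>, of total mass 1.\<close>
  also have "\<dots> = (\<integral>\<^sup>+y. ennreal (exponential_density (1 / h k) y) *
      (ennreal (h k) * (\<Prod>i\<in>?J. emeasure exp_law (F i))) \<partial>lborel)"
  proof (rule nn_integral_cong)
    fix y :: real
    have "ennreal (exp (- y)) * ennreal (exp (- ((1 - h k) / h k * y))) =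
        ennreal (exp (- (y / h k)) / h k) * ennreal (h k)"
      using assms(3) by (simp add: exp_add[symmetric] field_simps flip: ennreal_mult)
    then show "ennreal (exponential_density 1 y) *
        (ennreal (exp (- ((1 - h k) / h k * y))) * (\<Prod>i\<in>?J. emeasure exp_law (F i))) =
        ennreal (exponential_density (1 / h k) y) *
        (ennreal (h k) * (\<Prod>i\<in>?J. emeasure exp_law (F i)))"
      by (cases "y < 0") (simp_all add: exponential_density_def mult.assoc[symmetric])
  qed
  also have "\<dots> = emeasure (density lborel (exponential_density (1 / h k))) UNIV *
      (ennreal (h k) * (\<Prod>i\<in>?J. emeasure exp_law (F i)))"
    by (simp add: nn_integral_multc emeasure_density)
  also have "emeasure (density lborel (exponential_density (1 / h k))) UNIV = 1"
    using prob_space.emeasure_space_1[OF prob_space_exponential_density[of "1 / h k"]] assms(3) by simp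
  finally show ?thesis by simp
qed


text \<open>No tie has to be examined: the winning events are disjoint, and their probabilities
  \<open>h k\<close> already exhaust the total mass 1.\<close>

lemma AE_race_winner:
  assumes "finite I" "\<And>i. i \<in> I \<Longrightarrow> 0 \<le> h i" "sum h I = 1"
  shows "AE e in \<Pi>\<^sub>M i\<in>I. exp_law. \<exists>k. race_winner I h k e"
proof -
  let ?P = "\<Pi>\<^sub>M i\<in>I. exp_law"
  interpret P: prob_space ?P
    by (intro prob_space_PiM prob_space_exp_law)
  define A where "A k = {e \<in> space ?P. race_winner I h k e}" for k
  define K where "K = {k \<in> I. 0 < h k}"
  have A: "A k \<in> sets ?P" "emeasure ?P (A k) = ennreal (h k)" if "k \<in> K" for k
  proof -
    have k: "k \<in> I" "0 < h k" using that by (auto simp: K_def)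
    \<comment> \<open>The vacuous constraint \<open>UNIV\<close> brings the event into the form
      treated by \<open>race_excess_law\<close>.\<close>
    have A_eq: "A k = {e \<in> space ?P. \<forall>i\<in>I - {k}. 0 < race_excess h k e i \<and> race_excess h k e i \<in> UNIV}"
      using k by (auto simp: A_def race_winner_def)
    show "A k \<in> sets ?P"
      unfolding A_eq using assms k by (intro sets_race_excess) auto
    show "emeasure ?P (A k) = ennreal (h k)"
      unfolding A_eq using assms k prob_space.emeasure_space_1[OF prob_space_exp_law]
      by (subst race_excess_law) auto
  qed
  have "finite K" using assms(1) by (simp add: K_def)
  have "disjoint_family_on A K"
    using race_winner_unique[of I h] by (force simp: disjoint_family_on_def A_def)
  with A \<open>finite K\<close> have "emeasure ?P (\<Union>k\<in>K. A k) = (\<Sum>k\<in>K. ennreal (h k))"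
    by (subst sum_emeasure[symmetric]) auto
  also have "\<dots> = ennreal (\<Sum>k\<in>K. h k)"
    by (rule sum_ennreal) (auto simp: K_def)
  also have "(\<Sum>k\<in>K. h k) = sum h I"
    using assms by (intro sum.mono_neutral_left) (auto simp: K_def less_le)
  finally have "AE e in ?P. e \<in> (\<Union>k\<in>K. A k)"
    using A \<open>finite K\<close> assms(3) by (subst P.AE_in_set_eq_1) (auto simp: P.emeasure_eq_measure)
  then show ?thesis
    by eventually_elim (auto simp: A_def)
qed

text \<open>For positive \<open>h i\<close>, \<open>ln (h i) + g i\<close> equals
  \<open>- ln (e i / h i)\<close>, so a larger score means an earlier arrival. A strict race winner
  therefore beats every other index strictly, and an index of probability 0 has score
  \<open>- \<infinity>\<close>.\<close>

lemma is_arg_max_race_winner: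
  assumes "\<And>i. i \<in> I \<Longrightarrow> 0 \<le> h i"
    and max: "is_arg_max (\<lambda>j. elog (h j) + ereal (g j)) (\<lambda>j. j \<in> I) l"
    and win: "race_winner I h k e" and e: "\<And>i. i \<in> I \<Longrightarrow> e i = exp (- g i)"
  shows "l = k"
proof (rule ccontr)
  assume "l \<noteq> k"
  have l: "l \<in> I" and le: "\<not> elog (h l) + ereal (g l) < elog (h k) + ereal (g k)"
    using max win by (auto simp: is_arg_max_def race_winner_def)
  have k: "k \<in> I" "0 < h k" and ex: "h l / h k * exp (- g k) < exp (- g l)"
    using win l \<open>l \<noteq> k\<close> e by (auto simp: race_winner_def race_excess_def)
  show False
  proof (cases "h l = 0")
    case True
    with le k show False by (simp add: elog_def)
  next
    case False
    with assms(1)[OF l] have hl: "0 < h l" by simp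
    with ex k have "ln (h l / h k * exp (- g k)) < ln (exp (- g l))"
      by (subst ln_less_cancel_iff) auto
    with hl k have "ln (h l) + g l < ln (h k) + g k"
      by (simp add: ln_mult ln_div)
    with le hl k show False by (simp add: elog_def)
  qed
qed

section \<open>Transfer to the underlying probability space, given an event\<close>

text \<open>Here \<open>A\<close> is the past on which one conditions, and \<open>law\<close> says
  that given \<open>A\<close> the clocks are independent exponentials. Writing conditional
  statements as products with \<open>emeasure M A\<close> lets null events \<open>A\<close> be
  treated alike.\<close>

lemma (in prob_space) race_step:
  fixes E :: "'a \<Rightarrow> 'i \<Rightarrow> real" and K :: "'a \<Rightarrow> 'i"
  assumes I: "finite I" and h: "\<And>i. i \<in> I \<Longrightarrow> 0 \<le> h i" "sum h I = 1"
    and A: "A \<in> events" and E: "E \<in> measurable M (\<Pi>\<^sub>M i\<in>I. borel)"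
    and K: "K \<in> measurable M (count_space I)"
    and law: "\<And>B. B \<in> sets (\<Pi>\<^sub>M i\<in>I. borel) \<Longrightarrow>
      emeasure M (A \<inter> (E -` B \<inter> space M)) = emeasure M A * emeasure (\<Pi>\<^sub>M i\<in>I. exp_law) B"
    and first: "AE \<omega> in M. \<omega> \<in> A \<longrightarrow> (\<forall>k. race_winner I h k (E \<omega>) \<longrightarrow> K \<omega> = k)"
  shows "AE \<omega> in M. \<omega> \<in> A \<longrightarrow> race_winner I h (K \<omega>) (E \<omega>)" (is ?winner)
    and "\<And>k F. k \<in> I \<Longrightarrow> 0 < h k \<Longrightarrow> (\<And>i. i \<in> I - {k} \<Longrightarrow> F i \<in> sets borel) \<Longrightarrow>
      emeasure M {\<omega> \<in> A. K \<omega> = k \<and>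
          (\<forall>i\<in>I - {k}. 0 < race_excess h k (E \<omega>) i \<and> race_excess h k (E \<omega>) i \<in> F i)} =
        emeasure M A * (ennreal (h k) * (\<Prod>i\<in>I - {k}. emeasure exp_law (F i)))"
    and "\<And>k. k \<in> I \<Longrightarrow> emeasure M {\<omega> \<in> A. K \<omega> = k} = emeasure M A * ennreal (h k)"
proof -
  let ?P = "\<Pi>\<^sub>M i\<in>I. exp_law" and ?B = "\<Pi>\<^sub>M i\<in>I. borel :: real measure"
  have sets_P: "sets ?P = sets ?B"
    by (intro sets_PiM_cong) auto
  note space_P = sets_eq_imp_space_eq[OF sets_P]
  show ?winner
  proof -
    \<comment> \<open>The exceptional set of races is enclosed in a null set, which
      \<open>law\<close> pulls back to a null subset of \<open>A\<close>.\<close>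
    obtain Z where Z: "Z \<in> null_sets ?P" "{e \<in> space ?P. \<not> (\<exists>k. race_winner I h k e)} \<subseteq> Z"
      using AE_race_winner[OF I h] unfolding eventually_ae_filter by blast
    have "emeasure M (A \<inter> (E -` Z \<inter> space M)) = 0"
      using law[of Z] null_setsD1[OF Z(1)] null_setsD2[OF Z(1)] by (simp only: sets_P mult_zero_right)
    moreover have "A \<inter> (E -` Z \<inter> space M) \<in> events"
      using null_setsD2[OF Z(1)] by (intro sets.Int[OF A] measurable_sets[OF E]) (simp only: sets_P)
    ultimately have "AE \<omega> in M. \<omega> \<notin> A \<inter> (E -` Z \<inter> space M)"
      by (intro AE_not_in) auto
    with first AE_space show ?thesis
    proof eventually_elim
      case (elim \<omega>)
      moreover have "E \<omega> \<in> space ?P"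
        using measurable_space[OF E elim(2)] by (simp add: space_P)
      ultimately show ?case using Z(2) by blast
    qed
  qed
  note winner = this
  have ev: "{\<omega> \<in> A. K \<omega> = k} \<in> events" for k
  proof -
    \<comment> \<open>As \<open>k\<close> is arbitrary, the singleton is intersected with
      \<open>I\<close> to be a set of \<open>count_space I\<close>.\<close>
    have "{\<omega> \<in> A. K \<omega> = k} = A \<inter> (K -` ({k} \<inter> I) \<inter> space M)"
      using sets.sets_into_space[OF A] measurable_space[OF K] by auto
    also have "\<dots> \<in> events"
      by (intro sets.Int[OF A] measurable_sets[OF K]) auto
    finally show ?thesis .
  qed
  show excess: "emeasure M {\<omega> \<in> A. K \<omega> = k \<and>
          (\<forall>i\<in>I - {k}. 0 < race_excess h k (E \<omega>) i \<and> race_excess h k (E \<omega>) i \<in> F i)} =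
        emeasure M A * (ennreal (h k) * (\<Prod>i\<in>I - {k}. emeasure exp_law (F i)))"
    (is "emeasure M ?L = _")
    if k: "k \<in> I" "0 < h k" and F: "\<And>i. i \<in> I - {k} \<Longrightarrow> F i \<in> sets borel" for k F
  proof -
    let ?S = "\<lambda>D. {e \<in> space (\<Pi>\<^sub>M i\<in>I. D). \<forall>i\<in>I - {k}. 0 < race_excess h k e i \<and> race_excess h k e i \<in> F i}"
    let ?R = "A \<inter> (E -` ?S borel \<inter> space M)"
    have S: "?S borel \<in> sets ?B"
      using I k F by (intro sets_race_excess) auto
    have R: "?R \<in> events"
      by (intro sets.Int[OF A] measurable_sets[OF E] S)
    have L: "?L = {\<omega> \<in> A. K \<omega> = k} \<inter> ?R"
      using sets.sets_into_space[OF A] measurable_space[OF E] by auto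
    have "emeasure M ?L = emeasure M ?R"
    proof (rule emeasure_eq_AE)
      \<comment> \<open>Positivity of all excesses makes \<open>k\<close> the winner, and
        \<open>first\<close> then yields \<open>K \<omega> = k\<close> almost surely.\<close>
      show "AE \<omega> in M. \<omega> \<in> ?L \<longleftrightarrow> \<omega> \<in> ?R"
        using first
      proof eventually_elim
        case (elim \<omega>)
        then show ?case
          using k unfolding L by (auto simp: race_winner_def)
      qed
      show "?L \<in> events" unfolding L by (rule sets.Int[OF ev R])
    qed (rule R)
    also have "\<dots> = emeasure M A * emeasure ?P (?S exp_law)"
      using law[OF S] by (simp add: space_P)
    also have "emeasure ?P (?S exp_law) = ennreal (h k) * (\<Prod>i\<in>I - {k}. emeasure exp_law (F i))"
      using I h k F by (intro race_excess_law) auto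
    finally show ?thesis .
  qed
  show "emeasure M {\<omega> \<in> A. K \<omega> = k} = emeasure M A * ennreal (h k)" if k: "k \<in> I" for k
  proof (cases "h k = 0")
    case True
    \<comment> \<open>A winner has positive probability parameter, so such a \<open>k\<close> is
      almost never chosen on \<open>A\<close>.\<close>
    have "emeasure M {\<omega> \<in> A. K \<omega> = k} = emeasure M {}"
      using winner True ev by (intro emeasure_eq_AE) (auto elim!: eventually_mono simp: race_winner_def)
    then show ?thesis by (simp add: True)
  next
    case False
    with h(1) k have hk: "0 < h k" by (simp add: less_le)
    let ?L = "{\<omega> \<in> A. K \<omega> = k \<and>
          (\<forall>i\<in>I - {k}. 0 < race_excess h k (E \<omega>) i \<and> race_excess h k (E \<omega>) i \<in> UNIV)}"
    have "?L = {\<omega> \<in> A. K \<omega> = k} \<inter> (E -` {e \<in> space ?B. \<forall>i\<in>I - {k}. 0 < race_excess h k e i \<and> race_excess h k e i \<in> UNIV} \<inter> space M)"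
      using sets.sets_into_space[OF A] measurable_space[OF E] by auto
    also have "\<dots> \<in> events"
      using I k by (intro sets.Int[OF ev] measurable_sets[OF E] sets_race_excess) auto
    finally have "emeasure M {\<omega> \<in> A. K \<omega> = k} = emeasure M ?L"
      using winner ev by (intro emeasure_eq_AE) (auto elim!: eventually_mono simp: race_winner_def)
    also have "\<dots> = emeasure M A * (ennreal (h k) * (\<Prod>i\<in>I - {k}. emeasure exp_law UNIV))"
      using k hk by (rule excess) auto
    finally show ?thesis
      using prob_space.emeasure_space_1[OF prob_space_exp_law] by simp
  qed
qed

text \<open>Rectangles determine a product measure: for non-null \<open>A\<close>, the law of
  \<open>E\<close> under the conditional measure \<open>uniform_measure M A\<close> is identified by
  its values on them.\<close>

lemma (in prob_space) independent_exp_lawI: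
  assumes I: "finite I" and A [measurable]: "A \<in> events"
    and E [measurable]: "E \<in> measurable M (\<Pi>\<^sub>M i\<in>I. borel)"
    and rect: "\<And>F. (\<And>i. i \<in> I \<Longrightarrow> F i \<in> sets borel) \<Longrightarrow>
      emeasure M {\<omega> \<in> A. \<forall>i\<in>I. E \<omega> i \<in> F i} = emeasure M A * (\<Prod>i\<in>I. emeasure exp_law (F i))"
    and B: "B \<in> sets (\<Pi>\<^sub>M i\<in>I. borel)"
  shows "emeasure M (A \<inter> (E -` B \<inter> space M)) = emeasure M A * emeasure (\<Pi>\<^sub>M i\<in>I. exp_law) B"
proof (cases "emeasure M A = 0")
  case True
  have "emeasure M (A \<inter> (E -` B \<inter> space M)) \<le> emeasure M A"
    using A by (intro emeasure_mono) auto
  with True show ?thesis by simp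
next
  case False
  let ?P = "\<Pi>\<^sub>M i\<in>I. exp_law" and ?B = "\<Pi>\<^sub>M i\<in>I. borel :: real measure"
  have sets_P: "sets ?P = sets ?B"
    by (intro sets_PiM_cong) auto
  have A_finite: "emeasure M A \<noteq> \<top>" by simp
  have E': "E \<in> measurable (uniform_measure M A) ?P"
    using E measurable_cong_sets[OF sets_uniform_measure sets_P] by blast
  interpret product_sigma_finite "\<lambda>_. exp_law"
    by unfold_locales
      (rule sigma_finite_measure.sigma_finite_countable[OF prob_space_imp_sigma_finite[OF prob_space_exp_law]])
  have eq: "emeasure (distr (uniform_measure M A) ?P E) C =
      emeasure M (A \<inter> (E -` C \<inter> space M)) / emeasure M A" if "C \<in> sets ?B" for C
    using that E' measurable_sets[OF E that] by (subst emeasure_distr) (auto simp: sets_P)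
  have "distr (uniform_measure M A) ?P E = ?P"
  proof (rule PiM_eqI[OF I])
    fix F :: "'b \<Rightarrow> real set" assume F: "\<And>i. i \<in> I \<Longrightarrow> F i \<in> sets exp_law"
    then have "(\<Pi>\<^sub>E i\<in>I. F i) \<in> sets ?B"
      using I by (intro sets_PiM_I_finite) auto
    moreover have "A \<inter> (E -` (\<Pi>\<^sub>E i\<in>I. F i) \<inter> space M) = {\<omega> \<in> A. \<forall>i\<in>I. E \<omega> i \<in> F i}"
      using sets.sets_into_space[OF A] measurable_space[OF E]
      by (fastforce simp: space_PiM PiE_iff)
    ultimately show "emeasure (distr (uniform_measure M A) ?P E) (Pi\<^sub>E I F) =
        (\<Prod>i\<in>I. emeasure exp_law (F i))"
      using F False A_finite by (simp add: eq rect mult_divide_eq_ennreal mult.commute[of "emeasure M A"])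
  qed simp
  then have "emeasure ?P B = emeasure M (A \<inter> (E -` B \<inter> space M)) / emeasure M A"
    using eq[OF B] by simp
  then show ?thesis
    using False A_finite by (simp add: ennreal_times_divide mult_divide_eq_ennreal mult.commute[of "emeasure M A"])
qed

section \<open>The noise recursion in terms of residual clocks\<close>

text \<open>The two cdf values are \<open>exp (- e i)\<close> and
  \<open>exp (- (h i / h k * e k))\<close>, so their quotient is
  \<open>exp (- race_excess h k e i)\<close>. Since \<open>exp (- gumbel_quantile u)\<close> is
  \<open>- ln u\<close> for \<open>u\<close> in (0,1), positivity of the excess gives the
  claim.\<close>

lemma gumbel_recursion_excess:
  assumes "0 < h k" "0 \<le> h i" "\<And>j. e j = exp (- a j)" "0 < race_excess h k e i"
  shows "exp (- gumbel_quantile (gumbel_cdf (ereal (a i)) /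
      gumbel_cdf (ereal (a k) + elog (h k) - elog (h i)))) = race_excess h k e i"
proof (cases "h i = 0")
  case True
  \<comment> \<open>For \<open>h i = 0\<close> the denominator is evaluated at infinity, so the
    noise is carried over unchanged, in agreement with the excess \<open>e i\<close>.\<close>
  have "gumbel_cdf \<infinity> = 1"
    by (simp only: gumbel_cdf_def infinity_ereal_def ereal.case)
  with True assms show ?thesis
    by (simp add: elog_def gumbel_quantile_cdf race_excess_def)
next
  case False
  with assms(1,2) have hi: "0 < h i" by simp
  have "exp (- (a k + ln (h k) - ln (h i))) = h i / h k * e k"
    using hi assms(1,3) by (simp add: exp_diff exp_minus exp_add field_simps)
  then have "gumbel_cdf (ereal (a i)) / gumbel_cdf (ereal (a k) + elog (h k) - elog (h i)) =
      exp (- race_excess h k e i)"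
    using hi assms(1,3) by (simp add: elog_def gumbel_cdf_def race_excess_def exp_diff[symmetric])
  with assms(4) show ?thesis
    by (simp add: gumbel_quantile_def)
qed

section \<open>Events determined by the tokens and the history\<close>

lemma tokens_upto_0: "tokens_upto Y 0 \<omega> = []"
  by (simp add: tokens_upto_def)

lemma tokens_upto_Suc: "tokens_upto Y (Suc t) \<omega> = tokens_upto Y t \<omega> @ [Y (Suc t) \<omega>]"
  by (simp add: tokens_upto_def)

lemma tokens_upto_eq_iff:
  "tokens_upto Y t \<omega> = ys \<longleftrightarrow> length ys = t \<and> (\<forall>s\<in>{1..t}. Y s \<omega> = ys ! (s - 1))"
proof -
  have "tokens_upto Y t \<omega> = ys \<longleftrightarrow> length ys = t \<and> (\<forall>s<t. Y (Suc s) \<omega> = ys ! s)"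
    by (auto simp: tokens_upto_def list_eq_iff_nth_eq simp del: upt_Suc)
  also have "(\<forall>s<t. Y (Suc s) \<omega> = ys ! s) \<longleftrightarrow> (\<forall>s\<in>{1..t}. Y s \<omega> = ys ! (s - 1))"
    by (metis One_nat_def Suc_le_eq Suc_pred atLeastAtMost_iff diff_Suc_1 less_eq_Suc_le zero_less_Suc)
  finally show ?thesis .
qed

lemma sets_tokens_upto:
  assumes "\<And>s. s \<in> {1..t} \<Longrightarrow> Y s \<in> measurable M (count_space I)"
  shows "{\<omega> \<in> space M. tokens_upto Y t \<omega> = ys} \<in> sets M"
proof -
  have "{\<omega> \<in> space M. Y s \<omega> = c} \<in> sets M" if "s \<in> {1..t}" for s c
  proof -
    have "{\<omega> \<in> space M. Y s \<omega> = c} = Y s -` ({c} \<inter> I) \<inter> space M"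
      using measurable_space[OF assms[OF that]] by auto
    also have "\<dots> \<in> sets M"
      by (intro measurable_sets[OF assms[OF that]]) simp
    finally show ?thesis .
  qed
  then show ?thesis
    unfolding tokens_upto_eq_iff by (intro sets.sets_Collect sets.sets_Collect_finite_All) auto
qed

text \<open>Independence of the fresh draw is assumed relative to the sigma-algebra generated by
  \<open>history\<close>. The event of a given token prefix together with conditions on the residual
  clocks is therefore exhibited as a preimage under \<open>history\<close>.\<close>

lemma history_event:
  assumes Y: "\<And>s. s \<in> {1..t} \<Longrightarrow> Y s \<in> measurable M (count_space {1..N})"
    and t: "1 \<le> t" and k: "k \<in> {1..N}" and F: "\<And>i. i \<in> {1..N} - {k} \<Longrightarrow> F i \<in> sets borel"
  shows "{\<omega> \<in> space M. tokens_upto Y t \<omega> = ys \<and> (\<forall>i\<in>{1..N} - {k}.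
      0 < race_excess h k (\<lambda>i\<in>{1..N}. exp (- g t i \<omega>)) i \<and>
      race_excess h k (\<lambda>i\<in>{1..N}. exp (- g t i \<omega>)) i \<in> F i)}
    \<in> sets (vimage_algebra (space M) (history N g Y t) (history_space N t))"
proof -
  let ?H = "history_space N t" and ?B = "\<Pi>\<^sub>M i\<in>{1..N}. borel :: real measure"
  let ?R = "{e \<in> space ?B. \<forall>i\<in>{1..N} - {k}. 0 < race_excess h k e i \<and> race_excess h k e i \<in> F i}"
  let ?e = "\<lambda>f. \<lambda>i\<in>{1..N}. exp (- fst (f t) i :: real)"
  let ?S = "{f \<in> space ?H. length ys = t \<and> (\<forall>s\<in>{1..t}. snd (f s) = ys ! (s - 1))} \<inter> (?e -` ?R \<inter> space ?H)"
  have comp: "(\<lambda>f. f s) \<in> measurable ?H (?B \<Otimes>\<^sub>M count_space {1..N})" if "s \<in> {1..t}" for s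
    using that unfolding history_space_def by measurable
  have snd: "(\<lambda>f. snd (f s)) \<in> measurable ?H (count_space {1..N})" if "s \<in> {1..t}" for s
    using measurable_compose[OF comp[OF that] measurable_snd] .
  have fst: "(\<lambda>f. fst (f t)) \<in> measurable ?H ?B"
    using measurable_compose[OF comp measurable_fst] t by simp
  have "(\<lambda>f. exp (- fst (f t) i)) \<in> borel_measurable ?H" if "i \<in> {1..N}" for i
    using measurable_compose[OF fst measurable_component_singleton[OF that]] by measurable
  then have e: "?e \<in> measurable ?H ?B"
    by (rule measurable_restrict)
  have "{f \<in> space ?H. snd (f s) = c} \<in> sets ?H" if "s \<in> {1..t}" for s c
  proof -
    have "{f \<in> space ?H. snd (f s) = c} = (\<lambda>f. snd (f s)) -` ({c} \<inter> {1..N}) \<inter> space ?H"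
      using measurable_space[OF snd[OF that]] by auto
    also have "\<dots> \<in> sets ?H"
      by (intro measurable_sets[OF snd[OF that]]) simp
    finally show ?thesis .
  qed
  then have "{f \<in> space ?H. length ys = t \<and> (\<forall>s\<in>{1..t}. snd (f s) = ys ! (s - 1))} \<in> sets ?H"
    by (intro sets.sets_Collect sets.sets_Collect_finite_All) auto
  moreover have "?e -` ?R \<inter> space ?H \<in> sets ?H"
    using k F by (intro measurable_sets[OF e] sets_race_excess) auto
  ultimately have S: "?S \<in> sets ?H"
    by (rule sets.Int)
  have history: "history N g Y t \<omega> \<in> space ?H" if "\<omega> \<in> space M" for \<omega>
    using measurable_space[OF Y that]
    by (auto simp: history_def history_space_def space_PiM space_pair_measure)
  have e_history: "?e (history N g Y t \<omega>) = (\<lambda>i\<in>{1..N}. exp (- g t i \<omega>))" for \<omega>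
    using t by (auto simp: history_def restrict_def)
  have "history N g Y t -` ?S \<inter> space M =
      {\<omega> \<in> space M. tokens_upto Y t \<omega> = ys \<and> (\<lambda>i\<in>{1..N}. exp (- g t i \<omega>)) \<in> ?R}"
  proof -
    have "history N g Y t \<omega> \<in> ?S \<longleftrightarrow>
        tokens_upto Y t \<omega> = ys \<and> (\<lambda>i\<in>{1..N}. exp (- g t i \<omega>)) \<in> ?R" if "\<omega> \<in> space M" for \<omega>
    proof -
      have "snd (history N g Y t \<omega> s) = Y s \<omega>" if "s \<in> {1..t}" for s
        using that by (simp add: history_def)
      then show ?thesis
        unfolding Int_iff vimage_eq mem_Collect_eq e_history tokens_upto_eq_iff
        using history[OF that] by (metis (no_types, lifting))
    qed
    then show ?thesis by blast
  qed
  also have "\<dots> = {\<omega> \<in> space M. tokens_upto Y t \<omega> = ys \<and> (\<forall>i\<in>{1..N} - {k}.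
      0 < race_excess h k (\<lambda>i\<in>{1..N}. exp (- g t i \<omega>)) i \<and>
      race_excess h k (\<lambda>i\<in>{1..N}. exp (- g t i \<omega>)) i \<in> F i)}"
    by (auto simp: space_PiM)
  finally show ?thesis
    using in_vimage_algebra[OF S, of "history N g Y t" "space M"] by simp
qed

section \<open>Induction along the sequence of tokens\<close>

theorem theorem4p2:
  fixes M :: "'a measure"
    and N T :: nat
    and X :: "nat list"
    and \<pi> :: "nat list \<Rightarrow> nat list \<Rightarrow> nat \<Rightarrow> real"
    and g :: "nat \<Rightarrow> nat \<Rightarrow> 'a \<Rightarrow> real"
    and Y :: "nat \<Rightarrow> 'a \<Rightarrow> nat"
  defines "h \<equiv> token_probs \<pi> X Y"
  assumes "prob_space M"
    and "N \<ge> 1" and "T \<ge> 1"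
    and "set X \<subseteq> {1..N}"
    and "language_model N \<pi>"
    and "\<And>t i. t \<in> {1..T} \<Longrightarrow> i \<in> {1..N} \<Longrightarrow> g t i \<in> borel_measurable M"
    and "\<And>t. t \<in> {1..T} \<Longrightarrow> Y t \<in> measurable M (count_space {1..N})"
    and g1_distributed: "\<And>i. i \<in> {1..N} \<Longrightarrow> std_gumbel M (g 1 i)"
    and g1_independent: "prob_space.indep_vars M (\<lambda>_. borel) (g 1) {1..N}"
    and argmax: "\<And>t. t \<in> {1..T} \<Longrightarrow>
      AE \<omega> in M. is_arg_max (\<lambda>j. elog (h t \<omega> j) + ereal (g t j \<omega>)) (\<lambda>j. j \<in> {1..N}) (Y t \<omega>)"
    and fresh_distributed: "\<And>t. 1 \<le> t \<Longrightarrow> t < T \<Longrightarrow> std_gumbel M (\<lambda>\<omega>. g (t + 1) (Y t \<omega>) \<omega>)"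
    and fresh_independent: "\<And>t. 1 \<le> t \<Longrightarrow> t < T \<Longrightarrow>
      prob_space.indep_set M
        (sets (vimage_algebra (space M) (history N g Y t) (history_space N t)))
        (sets (vimage_algebra (space M) (\<lambda>\<omega>. g (t + 1) (Y t \<omega>) \<omega>) borel))"
    and recursion: "\<And>t. 1 \<le> t \<Longrightarrow> t < T \<Longrightarrow>
      AE \<omega> in M. \<forall>i\<in>{1..N}. i \<noteq> Y t \<omega> \<longrightarrow>
        g (t + 1) i \<omega> =
          gumbel_quantile
            (gumbel_cdf (ereal (g t i \<omega>)) /
             gumbel_cdf (ereal (g t (Y t \<omega>) \<omega>) + elog (h t \<omega> (Y t \<omega>)) - elog (h t \<omega> i)))"
  shows "\<forall>t<T. \<forall>y\<in>{1..N}. \<forall>ys.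
    \<P>(\<omega> in M. tokens_upto Y t \<omega> = ys) > 0 \<longrightarrow>
    \<P>(\<omega> in M. Y (t + 1) \<omega> = y \<bar> tokens_upto Y t \<omega> = ys) = \<pi> X ys y"
proof -
  interpret prob_space M by fact
  have meas_g: "\<And>t i. t \<in> {1..T} \<Longrightarrow> i \<in> {1..N} \<Longrightarrow> g t i \<in> borel_measurable M"
    and meas_Y: "\<And>t. t \<in> {1..T} \<Longrightarrow> Y t \<in> measurable M (count_space {1..N})"
    by fact+
  let ?I = "{1..N}"
  define E where "E t \<omega> = (\<lambda>i\<in>?I. exp (- g t i \<omega>))" for t \<omega>
  define A where "A t ys = {\<omega> \<in> space M. tokens_upto Y t \<omega> = ys}" for t ys
  \<comment> \<open>The induction invariant: given the first \<open>t\<close> tokens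
    \<open>ys\<close>, the clocks at position \<open>t + 1\<close> are independent exponentials. It
    is meaningful for \<open>t < T\<close>.\<close>
  define exp_after where "exp_after t ys \<longleftrightarrow> (\<forall>B\<in>sets (\<Pi>\<^sub>M i\<in>?I. borel).
    emeasure M (A t ys \<inter> (E (t + 1) -` B \<inter> space M)) =
      emeasure M (A t ys) * emeasure (\<Pi>\<^sub>M i\<in>?I. exp_law) B)" for t ys
  have E: "E t \<in> measurable M (\<Pi>\<^sub>M i\<in>?I. borel)" if "t \<in> {1..T}" for t
    unfolding E_def[abs_def] using meas_g[OF that]
    by (intro measurable_restrict borel_measurable_exp borel_measurable_uminus) auto
  have A: "A t ys \<in> events" if "t \<le> T" for t ys
    unfolding A_def using meas_Y that by (intro sets_tokens_upto[where I = ?I]) auto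
  have A_empty: "A t ys = {}" if "t \<le> T" "\<not> set ys \<subseteq> ?I" for t ys
    using measurable_space[OF meas_Y] that
    by (force simp: A_def tokens_upto_def)
  have \<pi>: "0 \<le> \<pi> X ys i" "sum (\<pi> X ys) ?I = 1" if "set ys \<subseteq> ?I" "i \<in> ?I" for ys i
    using \<open>language_model N \<pi>\<close> \<open>set X \<subseteq> {1..N}\<close> that unfolding language_model_def by blast+
  \<comment> \<open>A witness that the vocabulary is nonempty, used for the normalisation in
    \<open>\<pi>\<close> and for the product law of the initial noise.\<close>
  have one: "1 \<in> ?I" using \<open>N \<ge> 1\<close> by simp
  have A_Suc: "A (Suc t) (ys @ [k]) = {\<omega> \<in> A t ys. Y (t + 1) \<omega> = k}" for t ys k
    by (auto simp: A_def tokens_upto_Suc)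
  have first: "AE \<omega> in M. \<omega> \<in> A t ys \<longrightarrow>
      (\<forall>k. race_winner ?I (\<pi> X ys) k (E (t + 1) \<omega>) \<longrightarrow> Y (t + 1) \<omega> = k)"
    if "t < T" "set ys \<subseteq> ?I" for t ys
  proof -
    have "t + 1 \<in> {1..T}" using that by simp
    from argmax[OF this] show ?thesis
    proof eventually_elim
      case (elim \<omega>)
      show ?case
      proof (intro impI allI)
        fix k assume "\<omega> \<in> A t ys" and win: "race_winner ?I (\<pi> X ys) k (E (t + 1) \<omega>)"
        then have "h (t + 1) \<omega> = \<pi> X ys"
          by (simp add: h_def token_probs_def A_def)
        with elim have "is_arg_max (\<lambda>j. elog (\<pi> X ys j) + ereal (g (t + 1) j \<omega>)) (\<lambda>j. j \<in> ?I) (Y (t + 1) \<omega>)"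
          by simp
        from is_arg_max_race_winner[OF \<pi>(1)[OF that(2)] this win]
        show "Y (t + 1) \<omega> = k" by (simp add: E_def)
      qed
    qed
  qed
  \<comment> \<open>On \<open>A t ys\<close> the random vector \<open>h (t + 1)\<close> is the
    constant \<open>\<pi> X ys\<close>, so \<open>race_step\<close> applies. The first two facts
    drive the induction; the third also gives the categorical law at the end.\<close>
  have race: "AE \<omega> in M. \<omega> \<in> A t ys \<longrightarrow> race_winner ?I (\<pi> X ys) (Y (t + 1) \<omega>) (E (t + 1) \<omega>)"
      "\<And>k F. k \<in> ?I \<Longrightarrow> 0 < \<pi> X ys k \<Longrightarrow> (\<And>i. i \<in> ?I - {k} \<Longrightarrow> F i \<in> sets borel) \<Longrightarrow>
        emeasure M {\<omega> \<in> A t ys. Y (t + 1) \<omega> = k \<and>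
            (\<forall>i\<in>?I - {k}. 0 < race_excess (\<pi> X ys) k (E (t + 1) \<omega>) i \<and>
              race_excess (\<pi> X ys) k (E (t + 1) \<omega>) i \<in> F i)} =
          emeasure M (A t ys) * (ennreal (\<pi> X ys k) * (\<Prod>i\<in>?I - {k}. emeasure exp_law (F i)))"
      "\<And>k. k \<in> ?I \<Longrightarrow> emeasure M (A (Suc t) (ys @ [k])) = emeasure M (A t ys) * ennreal (\<pi> X ys k)"
    if "t < T" "set ys \<subseteq> ?I" "exp_after t ys" for t ys
  proof -
    have t: "t + 1 \<in> {1..T}" "t \<le> T" using that(1) by auto
    have law: "emeasure M (A t ys \<inter> (E (t + 1) -` B \<inter> space M)) =
        emeasure M (A t ys) * emeasure (\<Pi>\<^sub>M i\<in>?I. exp_law) B"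
      if "B \<in> sets (\<Pi>\<^sub>M i\<in>?I. borel)" for B
      using \<open>exp_after t ys\<close> that by (simp add: exp_after_def)
    note step = race_step[OF finite_atLeastAtMost \<pi>(1)[OF that(2)] \<pi>(2)[OF that(2) one]
      A[OF t(2)] E[OF t(1)] meas_Y[OF t(1)] law first[OF that(1,2)]]
    show "AE \<omega> in M. \<omega> \<in> A t ys \<longrightarrow> race_winner ?I (\<pi> X ys) (Y (t + 1) \<omega>) (E (t + 1) \<omega>)"
      by (rule step(1))
    show "emeasure M {\<omega> \<in> A t ys. Y (t + 1) \<omega> = k \<and>
            (\<forall>i\<in>?I - {k}. 0 < race_excess (\<pi> X ys) k (E (t + 1) \<omega>) i \<and>
              race_excess (\<pi> X ys) k (E (t + 1) \<omega>) i \<in> F i)} =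
          emeasure M (A t ys) * (ennreal (\<pi> X ys k) * (\<Prod>i\<in>?I - {k}. emeasure exp_law (F i)))"
      if "k \<in> ?I" "0 < \<pi> X ys k" "\<And>i. i \<in> ?I - {k} \<Longrightarrow> F i \<in> sets borel" for k F
      by (rule step(2)[OF _ _ that])
    show "emeasure M (A (Suc t) (ys @ [k])) = emeasure M (A t ys) * ennreal (\<pi> X ys k)"
      if "k \<in> ?I" for k
      unfolding A_Suc by (rule step(3)[OF _ _ that])
  qed
  have exp_after: "exp_after t ys" if "t < T" for t ys
    using that
  proof (induction t arbitrary: ys)
    case (0 ys)
    have "indep_vars (\<lambda>_. borel) (\<lambda>i \<omega>. exp (- g 1 i \<omega>)) ?I"
      using indep_vars_compose2[OF g1_independent, of "\<lambda>_ x. exp (- x)" "\<lambda>_. borel"] by simp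
    moreover have "(\<lambda>\<omega>. exp (- g 1 i \<omega>)) \<in> borel_measurable M" if "i \<in> ?I" for i
      using meas_g[of 1 i] \<open>T \<ge> 1\<close> that by simp
    ultimately have "distr M (\<Pi>\<^sub>M i\<in>?I. borel) (E 1) =
        (\<Pi>\<^sub>M i\<in>?I. distr M borel (\<lambda>\<omega>. exp (- g 1 i \<omega>)))"
      unfolding E_def[abs_def] using one by (subst (asm) indep_vars_iff_distr_eq_PiM') auto
    also have "\<dots> = (\<Pi>\<^sub>M i\<in>?I. exp_law)"
      using g1_distributed by (intro PiM_cong refl std_gumbel_exp_law)
    finally have distr: "distr M (\<Pi>\<^sub>M i\<in>?I. borel) (E 1) = (\<Pi>\<^sub>M i\<in>?I. exp_law)" .
    have E1: "E 1 \<in> measurable M (\<Pi>\<^sub>M i\<in>?I. borel)"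
      using E \<open>T \<ge> 1\<close> by simp
    have "emeasure M (E 1 -` B \<inter> space M) = emeasure (\<Pi>\<^sub>M i\<in>?I. exp_law) B"
      if "B \<in> sets (\<Pi>\<^sub>M i\<in>?I. borel)" for B
      using emeasure_distr[OF E1 that] unfolding distr by simp
    then show ?case
      by (cases "ys = []")
        (simp_all add: exp_after_def A_def tokens_upto_0 emeasure_space_1 Int_absorb1)
  next
    case (Suc t ys)
    have t: "t < T" "t + 1 < T" "1 \<le> t + 1" "t + 2 \<in> {1..T}" using Suc.prems by auto
    show ?case
    \<comment> \<open>Impossible prefixes give empty events, for which the invariant is
      trivial.\<close>
    proof (cases "set ys \<subseteq> ?I \<and> length ys = Suc t")
      case False
      have "A (Suc t) ys = {}"
      proof (cases "set ys \<subseteq> ?I")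
        case True
        with False show ?thesis by (auto simp: A_def tokens_upto_eq_iff)
      qed (use A_empty[of "Suc t" ys] t in simp)
      then show ?thesis
        by (simp add: exp_after_def)
    next
      case True
      then obtain zs k where ys: "ys = zs @ [k]"
        by (auto simp: length_Suc_conv_rev)
      with True have zs: "set zs \<subseteq> ?I" and k: "k \<in> ?I" by auto
      let ?h = "\<pi> X zs"
      note race = race[OF t(1) zs Suc.IH[OF t(1)]]
      note A_ys = race(3)[OF k, folded ys]
      have A_ev: "A (Suc t) ys \<in> events" using A t by simp
      have E2: "E (t + 2) \<in> measurable M (\<Pi>\<^sub>M i\<in>?I. borel)" by (rule E[OF t(4)])
      have rect: "emeasure M {\<omega> \<in> A (Suc t) ys. \<forall>i\<in>?I. E (t + 2) \<omega> i \<in> F i} =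
          emeasure M (A (Suc t) ys) * (\<Prod>i\<in>?I. emeasure exp_law (F i))" (is "emeasure M ?L = _")
        if F: "\<And>i. i \<in> ?I \<Longrightarrow> F i \<in> sets borel" for F
      proof (cases "?h k = 0")
        case True
        then have "emeasure M (A (Suc t) ys) = 0" by (simp add: A_ys)
        moreover from this have "emeasure M ?L \<le> 0"
          using A_ev by (metis (no_types, lifting) emeasure_mono mem_Collect_eq subsetI)
        ultimately show ?thesis by simp
      next
        case False
        with \<pi>(1)[OF zs k] have hk: "0 < ?h k" by simp
        let ?Z = "\<lambda>\<omega>. g (t + 2) (Y (t + 1) \<omega>) \<omega>"
        \<comment> \<open>The rectangle event is split into \<open>?C\<close>, which depends on the
          history up to \<open>t + 1\<close>, and \<open>?D\<close>, which depends on the fresh draw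
          alone.\<close>
        let ?C = "{\<omega> \<in> space M. tokens_upto Y (t + 1) \<omega> = ys \<and> (\<forall>i\<in>?I - {k}.
          0 < race_excess ?h k (E (t + 1) \<omega>) i \<and> race_excess ?h k (E (t + 1) \<omega>) i \<in> F i)}"
        let ?D = "{\<omega> \<in> space M. exp (- ?Z \<omega>) \<in> F k}"
        have Z: "std_gumbel M ?Z"
          using fresh_distributed[OF t(3,2)] by (simp add: numeral_2_eq_2)
        then have Z_meas: "?Z \<in> borel_measurable M" by (simp add: std_gumbel_def)
        have C_hist: "?C \<in> sets (vimage_algebra (space M) (history N g Y (t + 1)) (history_space N (t + 1)))"
          unfolding E_def using t k F meas_Y by (intro history_event) auto
        have "(\<lambda>x::real. exp (- x)) -` F k \<inter> space borel \<in> sets borel"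
          using F[OF k] by (intro measurable_sets[where A = borel]) auto
        then have "?Z -` ((\<lambda>x. exp (- x)) -` F k \<inter> space borel) \<inter> space M
            \<in> sets (vimage_algebra (space M) ?Z borel)"
          by (rule in_vimage_algebra)
        also have "?Z -` ((\<lambda>x. exp (- x)) -` F k \<inter> space borel) \<inter> space M = ?D"
          by auto
        finally have D_fresh: "?D \<in> sets (vimage_algebra (space M) ?Z borel)" .
        note indep = fresh_independent[OF t(3,2), unfolded add.assoc one_add_one]
        have C_ev: "?C \<in> events" and D_ev: "?D \<in> events"
          using C_hist D_fresh indep_setD_ev1[OF indep] indep_setD_ev2[OF indep] by blast+
        have L_ev: "?L \<in> events"
        proof -
          have "?L = A (Suc t) ys \<inter> (E (t + 2) -` (\<Pi>\<^sub>E i\<in>?I. F i) \<inter> space M)"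
            using measurable_space[OF E2] by (fastforce simp: A_def space_PiM PiE_iff)
          also have "\<dots> \<in> events"
            using F by (intro sets.Int[OF A_ev] measurable_sets[OF E2] sets_PiM_I_finite) auto
          finally show ?thesis .
        qed
        \<comment> \<open>On the prefix \<open>ys\<close> the winner is \<open>k\<close>. Its new
          clock is the fresh one, the other clocks are the excesses by the recursion, and these are
          almost surely positive, as \<open>?C\<close> demands.\<close>
        have "AE \<omega> in M. \<omega> \<in> ?L \<longleftrightarrow> \<omega> \<in> ?C \<inter> ?D"
          using race(1) recursion[OF t(3,2)]
        proof eventually_elim
          case (elim \<omega>)
          show ?case
          proof (cases "\<omega> \<in> A (Suc t) ys")
            case True
            then have \<omega>: "\<omega> \<in> space M" "\<omega> \<in> A t zs" "Y (t + 1) \<omega> = k" "tokens_upto Y t \<omega> = zs"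
              "tokens_upto Y (t + 1) \<omega> = ys"
              by (auto simp: A_def ys tokens_upto_Suc)
            have excess: "E (t + 2) \<omega> i = race_excess ?h k (E (t + 1) \<omega>) i"
              "0 < race_excess ?h k (E (t + 1) \<omega>) i" if i: "i \<in> ?I - {k}" for i
            proof -
              show pos: "0 < race_excess ?h k (E (t + 1) \<omega>) i"
                using elim(1) \<omega> i by (auto simp: race_winner_def)
              have E_eq: "race_excess ?h k (E (t + 1) \<omega>) i =
                  race_excess ?h k (\<lambda>j. exp (- g (t + 1) j \<omega>)) i"
                using i k by (simp add: race_excess_def E_def)
              have "g (t + 2) i \<omega> = gumbel_quantile (gumbel_cdf (ereal (g (t + 1) i \<omega>)) /
                  gumbel_cdf (ereal (g (t + 1) k \<omega>) + elog (?h k) - elog (?h i)))"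
                using elim(2) \<omega> i by (auto simp: h_def token_probs_def numeral_2_eq_2)
              then show "E (t + 2) \<omega> i = race_excess ?h k (E (t + 1) \<omega>) i"
                using gumbel_recursion_excess[of ?h k i "\<lambda>j. exp (- g (t + 1) j \<omega>)" "\<lambda>j. g (t + 1) j \<omega>"]
                  hk \<pi>(1)[OF zs, of i] pos i unfolding E_eq by (simp add: E_def)
            qed
            have "E (t + 2) \<omega> k = exp (- ?Z \<omega>)"
              using k \<omega>(3) by (simp add: E_def)
            then have "(\<forall>i\<in>?I. E (t + 2) \<omega> i \<in> F i) \<longleftrightarrow>
                exp (- ?Z \<omega>) \<in> F k \<and> (\<forall>i\<in>?I - {k}. race_excess ?h k (E (t + 1) \<omega>) i \<in> F i)"
              using k excess(1) by (metis Diff_iff singletonD)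
            then show ?thesis
              using True \<omega> excess(2) by blast
          next
            case False
            then show ?thesis by (auto simp: A_def)
          qed
        qed
        then have "emeasure M ?L = emeasure M (?C \<inter> ?D)"
          using L_ev C_ev D_ev by (intro emeasure_eq_AE sets.Int)
        also have "\<dots> = emeasure M ?C * emeasure M ?D"
          using indep_setD[OF indep C_hist D_fresh]
          by (simp add: emeasure_eq_measure flip: ennreal_mult)
        also have "emeasure M ?D = emeasure exp_law (F k)"
          using F[OF k] Z_meas
          by (simp add: std_gumbel_exp_law[OF Z, symmetric] emeasure_distr vimage_def Int_def conj_commute)
        also have "?C = {\<omega> \<in> A t zs. Y (t + 1) \<omega> = k \<and> (\<forall>i\<in>?I - {k}.
            0 < race_excess ?h k (E (t + 1) \<omega>) i \<and> race_excess ?h k (E (t + 1) \<omega>) i \<in> F i)}"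
          by (auto simp: A_def ys tokens_upto_Suc)
        also have "emeasure M \<dots> = emeasure M (A t zs) *
            (ennreal (?h k) * (\<Prod>i\<in>?I - {k}. emeasure exp_law (F i)))"
          using k hk F by (intro race(2)) auto
        \<comment> \<open>The factor \<open>\<pi> X zs k\<close> combines with the mass of the
          prefix \<open>zs\<close> into the mass of \<open>ys\<close>, by the third fact of
          \<open>race\<close>.\<close>
        also have "\<dots> * emeasure exp_law (F k) =
            emeasure M (A (Suc t) ys) * (emeasure exp_law (F k) * (\<Prod>i\<in>?I - {k}. emeasure exp_law (F i)))"
          by (simp add: A_ys mult_ac)
        also have "emeasure exp_law (F k) * (\<Prod>i\<in>?I - {k}. emeasure exp_law (F i)) =
            (\<Prod>i\<in>?I. emeasure exp_law (F i))"
          using k by (intro prod.remove[symmetric]) auto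
        finally show ?thesis .
      qed
      show ?thesis
        unfolding exp_after_def
        using independent_exp_lawI[OF _ A_ev E2 rect] by simp
    qed
  qed
  show ?thesis
  proof (intro allI impI ballI)
    fix t y ys assume t: "t < T" and y: "y \<in> ?I" and pos: "\<P>(\<omega> in M. tokens_upto Y t \<omega> = ys) > 0"
    \<comment> \<open>A prefix of positive probability consists of vocabulary tokens, so that
      \<open>\<pi> X ys\<close> is a probability vector.\<close>
    then have "A t ys \<noteq> {}"
      by (metis A_def measure_empty less_irrefl)
    then have ys: "set ys \<subseteq> ?I"
      using A_empty[of t ys] t by auto
    have "emeasure M (A (Suc t) (ys @ [y])) = emeasure M (A t ys) * ennreal (\<pi> X ys y)"
      using race(3)[OF t ys exp_after[OF t] y] .
    then have "prob (A (Suc t) (ys @ [y])) = prob (A t ys) * \<pi> X ys y"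
      using \<pi>(1)[OF ys y] by (simp add: emeasure_eq_measure flip: ennreal_mult)
    moreover have "{\<omega> \<in> space M. Y (t + 1) \<omega> = y \<and> tokens_upto Y t \<omega> = ys} = A (Suc t) (ys @ [y])"
      by (auto simp: A_def tokens_upto_Suc)
    ultimately show "\<P>(\<omega> in M. Y (t + 1) \<omega> = y \<bar> tokens_upto Y t \<omega> = ys) = \<pi> X ys y"
      using pos by (simp add: cond_prob_def A_def)
  qed
qed

end
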